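(* Let $(U_A,\tau)$ and $(U_B,\delta)$ be soft topological spaces and $f:U_A\to U_B$ a soft function. Then $f$ is soft semicontinuous if and only if $f(\mathrm{sscl}\,F_A)\subseteq\overline{f(F_A)}$ for every soft set $F_A$ of $U_A$.
   Context: Soft sets. For a universe $U$ and a parameter set $A$, a soft set $F_A$ over $U$ is a map $F:A\to\mathcal P(U)$; $SS(U)_A$ is the set of all of them. $\Phi_A$ has all values $\emptyset$; $U_A$ has all values $U$. Soft inclusion, union, intersection and complement ($(F_A)^c$) are taken parameterwise. "A soft set of $U_A$" means a member of $SS(U)_A$; likewise for $U_B$ with parameter set $B$. Soft topology. A soft topology is a family $\tau\subseteq SS(U)_A$ containing $\Phi_A,U_A$, closed under arbitrary soft unions and under soft intersections of two members; $(U_A,\tau)$ is then a soft topological space. Members of $\tau$ are the open soft sets, their complements the closed soft sets. $\overline{F_A}$ is the intersection of all closed soft sets containing $F_A$, and $(F_A)^0$ is the union of all open soft sets contained in $F_A$. A soft set $G_A$ is semiopen if there is an open soft set $H_A$ with $H_A\subseteq G_A\subseteq\overline{H_A}$; $F_A$ is semiclosed if there is a closed soft set $K_A$ with $(K_A)^0\subseteq F_A\subseteq K_A$. $\mathrm{sscl}\,G_A$ is the intersection of all semiclosed soft sets containing $G_A$. A soft function $f:U_A\to U_B$ is given by maps $u:U\to U$ and $p:A\to B$; for $F_A\in SS(U)_A$ the image is $f(F_A)(b)=\bigcup_{a\in p^{-1}(b)}u(F(a))$ for $b\in B$, and for $G_B\in SS(U)_B$ the inverse image is $f^{-1}(G_B)(a)=u^{-1}(G(p(a)))$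 for $a\in A$. It is soft semicontinuous if $f^{-1}(G_B)$ is semiopen in $U_A$ for each open soft set $G_B$ of $U_B$. *)

theory Defs
  imports Main "HOL-Library.FuncSet"
begin

text \<open>
  The universe \<open>U\<close> and the parameter set \<open>A\<close> are arbitrary carrier sets (possibly empty).
  A soft set is an extensional function on \<open>A\<close>, so that equality in HOL is equality of maps
  from \<open>A\<close> to the powerset of \<open>U\<close>.
\<close>

definition soft_sets :: "'u set \<Rightarrow> 'a set \<Rightarrow> ('a \<Rightarrow> 'u set) set" where
  "soft_sets U A = A \<rightarrow>\<^sub>E Pow U"

definition soft_empty :: "'a set \<Rightarrow> 'a \<Rightarrow> 'u set" where
  "soft_empty A = (\<lambda>a\<in>A. {})"

definition soft_full :: "'u set \<Rightarrow> 'a set \<Rightarrow> 'a \<Rightarrow> 'u set" where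
  "soft_full U A = (\<lambda>a\<in>A. U)"

definition soft_subset :: "'a set \<Rightarrow> ('a \<Rightarrow> 'u set) \<Rightarrow> ('a \<Rightarrow> 'u set) \<Rightarrow> bool" where
  "soft_subset A F G \<longleftrightarrow> (\<forall>a\<in>A. F a \<subseteq> G a)"

definition soft_inter :: "'a set \<Rightarrow> ('a \<Rightarrow> 'u set) \<Rightarrow> ('a \<Rightarrow> 'u set) \<Rightarrow> 'a \<Rightarrow> 'u set" where
  "soft_inter A F G = (\<lambda>a\<in>A. F a \<inter> G a)"

definition soft_compl :: "'u set \<Rightarrow> 'a set \<Rightarrow> ('a \<Rightarrow> 'u set) \<Rightarrow> 'a \<Rightarrow> 'u set" where
  "soft_compl U A F = (\<lambda>a\<in>A. U - F a)"

definition soft_Union :: "'a set \<Rightarrow> ('a \<Rightarrow> 'u set) set \<Rightarrow> 'a \<Rightarrow> 'u set" where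
  "soft_Union A \<F> = (\<lambda>a\<in>A. \<Union>F\<in>\<F>. F a)"

text \<open>Intersections are taken inside \<open>U\<close>: the empty family has intersection \<open>soft_full U A\<close>.\<close>

definition soft_Inter :: "'u set \<Rightarrow> 'a set \<Rightarrow> ('a \<Rightarrow> 'u set) set \<Rightarrow> 'a \<Rightarrow> 'u set" where
  "soft_Inter U A \<F> = (\<lambda>a\<in>A. {x \<in> U. \<forall>F\<in>\<F>. x \<in> F a})"

definition soft_topology :: "'u set \<Rightarrow> 'a set \<Rightarrow> ('a \<Rightarrow> 'u set) set \<Rightarrow> bool" where
  "soft_topology U A \<tau> \<longleftrightarrow>
     \<tau> \<subseteq> soft_sets U A \<and> soft_empty A \<in> \<tau> \<and> soft_full U A \<in> \<tau> \<and>
     (\<forall>\<F>. \<F> \<subseteq> \<tau> \<longrightarrow> soft_Union A \<F> \<in> \<tau>) \<and>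
     (\<forall>F\<in>\<tau>. \<forall>G\<in>\<tau>. soft_inter A F G \<in> \<tau>)"

definition soft_closed :: "'u set \<Rightarrow> 'a set \<Rightarrow> ('a \<Rightarrow> 'u set) set \<Rightarrow> ('a \<Rightarrow> 'u set) \<Rightarrow> bool" where
  "soft_closed U A \<tau> K \<longleftrightarrow> (\<exists>H\<in>\<tau>. K = soft_compl U A H)"

definition soft_closure ::
  "'u set \<Rightarrow> 'a set \<Rightarrow> ('a \<Rightarrow> 'u set) set \<Rightarrow> ('a \<Rightarrow> 'u set) \<Rightarrow> 'a \<Rightarrow> 'u set" where
  "soft_closure U A \<tau> F = soft_Inter U A {K. soft_closed U A \<tau> K \<and> soft_subset A F K}"

definition soft_interior ::
  "'a set \<Rightarrow> ('a \<Rightarrow> 'u set) set \<Rightarrow> ('a \<Rightarrow> 'u set) \<Rightarrow> 'a \<Rightarrow> 'u set" where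
  "soft_interior A \<tau> F = soft_Union A {H \<in> \<tau>. soft_subset A H F}"

definition soft_semiopen ::
  "'u set \<Rightarrow> 'a set \<Rightarrow> ('a \<Rightarrow> 'u set) set \<Rightarrow> ('a \<Rightarrow> 'u set) \<Rightarrow> bool" where
  "soft_semiopen U A \<tau> G \<longleftrightarrow> G \<in> soft_sets U A \<and>
     (\<exists>H\<in>\<tau>. soft_subset A H G \<and> soft_subset A G (soft_closure U A \<tau> H))"

definition soft_semiclosed ::
  "'u set \<Rightarrow> 'a set \<Rightarrow> ('a \<Rightarrow> 'u set) set \<Rightarrow> ('a \<Rightarrow> 'u set) \<Rightarrow> bool" where
  "soft_semiclosed U A \<tau> F \<longleftrightarrow> F \<in> soft_sets U A \<and>
     (\<exists>K. soft_closed U A \<tau> K \<and> soft_subset A (soft_interior A \<tau> K) F \<and> soft_subset A F K)"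

definition sscl ::
  "'u set \<Rightarrow> 'a set \<Rightarrow> ('a \<Rightarrow> 'u set) set \<Rightarrow> ('a \<Rightarrow> 'u set) \<Rightarrow> 'a \<Rightarrow> 'u set" where
  "sscl U A \<tau> G = soft_Inter U A {F. soft_semiclosed U A \<tau> F \<and> soft_subset A G F}"

text \<open>
  A soft function is given by the pair \<open>u\<close>, \<open>p\<close>; only the values of \<open>u\<close> on \<open>U\<close> and of \<open>p\<close>
  on \<open>A\<close> matter.
\<close>

definition soft_function ::
  "'u set \<Rightarrow> 'a set \<Rightarrow> 'b set \<Rightarrow> ('u \<Rightarrow> 'u) \<Rightarrow> ('a \<Rightarrow> 'b) \<Rightarrow> bool" where
  "soft_function U A B u p \<longleftrightarrow> u \<in> U \<rightarrow> U \<and> p \<in> A \<rightarrow> B"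

definition soft_image ::
  "'a set \<Rightarrow> 'b set \<Rightarrow> ('u \<Rightarrow> 'u) \<Rightarrow> ('a \<Rightarrow> 'b) \<Rightarrow> ('a \<Rightarrow> 'u set) \<Rightarrow> 'b \<Rightarrow> 'u set" where
  "soft_image A B u p F = (\<lambda>b\<in>B. \<Union>a\<in>{a \<in> A. p a = b}. u ` F a)"

definition soft_vimage ::
  "'u set \<Rightarrow> 'a set \<Rightarrow> ('u \<Rightarrow> 'u) \<Rightarrow> ('a \<Rightarrow> 'b) \<Rightarrow> ('b \<Rightarrow> 'u set) \<Rightarrow> 'a \<Rightarrow> 'u set" where
  "soft_vimage U A u p G = (\<lambda>a\<in>A. {x \<in> U. u x \<in> G (p a)})"

definition soft_semicontinuous ::
  "'u set \<Rightarrow> 'a set \<Rightarrow> ('a \<Rightarrow> 'u set) set \<Rightarrow> ('b \<Rightarrow> 'u set) set \<Rightarrow>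
     ('u \<Rightarrow> 'u) \<Rightarrow> ('a \<Rightarrow> 'b) \<Rightarrow> bool" where
  "soft_semicontinuous U A \<tau> \<delta> u p \<longleftrightarrow>
     (\<forall>G\<in>\<delta>. soft_semiopen U A \<tau> (soft_vimage U A u p G))"

end

theory Submission
  imports Defs
begin

text \<open>
  A soft function \<open>f\<close> satisfies the usual adjunction \<open>f(F) \<subseteq> G \<longleftrightarrow> F \<subseteq> f\<^sup>-\<^sup>1(G)\<close>
  (\<open>soft_image_subset_iff\<close>), and its inverse image commutes with complements. As semiclosed
  soft sets are exactly the complements of semiopen ones (\<open>soft_semiclosed_compl_iff\<close>), \<open>f\<close> is
  semicontinuous iff inverse images of closed soft sets are semiclosed.

  If \<open>f\<close> is semicontinuous and \<open>K\<close> is a closed soft set containing \<open>f(F)\<close>, then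
  \<open>f\<^sup>-\<^sup>1(K)\<close> is semiclosed and contains \<open>F\<close>, hence contains \<open>sscl F\<close>; so
  \<open>f(sscl F) \<subseteq> K\<close>, and one intersects over all such \<open>K\<close>.

  Conversely, for closed \<open>K\<close> put \<open>F = f\<^sup>-\<^sup>1(K)\<close>. The closure of \<open>f(F)\<close> is contained
  in \<open>K\<close>, so the hypothesis gives \<open>f(sscl F) \<subseteq> K\<close>, that is \<open>sscl F \<subseteq> F\<close>. Thus
  \<open>F = sscl F\<close>, which is semiclosed because semiclosedness is stable under arbitrary
  intersections (\<open>soft_semiclosed_sscl\<close>). This stability follows from the
  characterisation of semiclosedness of \<open>F\<close> by the single inclusion
  \<open>int (cl F) \<subseteq> F\<close>, whose left-hand side is monotone in \<open>F\<close>.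
\<close>

lemma soft_subset_trans:
  "soft_subset A F G \<Longrightarrow> soft_subset A G H \<Longrightarrow> soft_subset A F H"
  by (fastforce simp: soft_subset_def)

lemma soft_subset_antisym:
  assumes "F \<in> soft_sets U A" "G \<in> soft_sets U A" "soft_subset A F G" "soft_subset A G F"
  shows "F = G"
  using assms unfolding soft_sets_def soft_subset_def
  by (intro PiE_ext) (auto simp: subset_antisym)

lemma soft_compl_in_soft_sets: "soft_compl U A F \<in> soft_sets U A"
  by (auto simp: soft_compl_def soft_sets_def)

lemma soft_Inter_in_soft_sets: "soft_Inter U A \<F> \<in> soft_sets U A"
  by (auto simp: soft_Inter_def soft_sets_def)

lemma soft_vimage_in_soft_sets: "soft_vimage U A u p G \<in> soft_sets U A"
  by (auto simp: soft_vimage_def soft_sets_def)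

lemma soft_sets_subset: "F \<in> soft_sets U A \<Longrightarrow> a \<in> A \<Longrightarrow> F a \<subseteq> U"
  by (auto simp: soft_sets_def)

lemma soft_subset_compl_iff:
  assumes "F \<in> soft_sets U A" "G \<in> soft_sets U A"
  shows "soft_subset A (soft_compl U A F) (soft_compl U A G) \<longleftrightarrow> soft_subset A G F"
proof -
  have "F a \<subseteq> U" "G a \<subseteq> U" if "a \<in> A" for a
    using assms that by (auto dest: soft_sets_subset)
  then show ?thesis
    unfolding soft_subset_def soft_compl_def by (fastforce simp: Ball_def)
qed

lemma soft_Inter_lower: "F \<in> \<F> \<Longrightarrow> soft_subset A (soft_Inter U A \<F>) F"
  by (auto simp: soft_subset_def soft_Inter_def)

lemma soft_Inter_greatest:
  assumes "F \<in> soft_sets U A" "\<And>G. G \<in> \<F> \<Longrightarrow> soft_subset A F G"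
  shows "soft_subset A F (soft_Inter U A \<F>)"
  using assms by (fastforce simp: soft_subset_def soft_Inter_def soft_sets_def)

lemma soft_closure_subset:
  "soft_closed U A \<tau> K \<Longrightarrow> soft_subset A F K \<Longrightarrow> soft_subset A (soft_closure U A \<tau> F) K"
  unfolding soft_closure_def by (rule soft_Inter_lower) simp

lemma subset_soft_closure:
  "F \<in> soft_sets U A \<Longrightarrow> soft_subset A F (soft_closure U A \<tau> F)"
  unfolding soft_closure_def by (rule soft_Inter_greatest) auto

lemma soft_closure_mono:
  "soft_subset A F G \<Longrightarrow> soft_subset A (soft_closure U A \<tau> F) (soft_closure U A \<tau> G)"
  unfolding soft_closure_def soft_Inter_def soft_subset_def by fastforce

lemma soft_interior_mono:
  "soft_subset A F G \<Longrightarrow> soft_subset A (soft_interior A \<tau> F) (soft_interior A \<tau> G)"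
  unfolding soft_interior_def soft_Union_def soft_subset_def by fastforce

lemma soft_closed_closure:
  assumes "soft_topology U A \<tau>"
  shows "soft_closed U A \<tau> (soft_closure U A \<tau> F)"
proof -
  define \<H> where "\<H> = {H \<in> \<tau>. soft_subset A F (soft_compl U A H)}"
  have "soft_Union A \<H> \<in> \<tau>"
    using assms by (auto simp: soft_topology_def \<H>_def)
  moreover have "soft_closure U A \<tau> F = soft_compl U A (soft_Union A \<H>)"
    unfolding soft_closure_def soft_Inter_def soft_Union_def soft_closed_def \<H>_def
    by (rule ext) (auto simp: soft_compl_def)
  ultimately show ?thesis
    by (auto simp: soft_closed_def)
qed

lemma soft_open_in_soft_sets: "soft_topology U A \<tau> \<Longrightarrow> H \<in> \<tau> \<Longrightarrow> H \<in> soft_sets U A"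
  by (auto simp: soft_topology_def)

lemma soft_compl_closure:
  assumes "soft_topology U A \<tau>" "H \<in> soft_sets U A"
  shows "soft_compl U A (soft_closure U A \<tau> H) = soft_interior A \<tau> (soft_compl U A H)"
proof
  fix a
  note open_subset = soft_sets_subset[OF soft_open_in_soft_sets[OF assms(1)]]
  have "soft_subset A H (soft_compl U A G) \<longleftrightarrow> soft_subset A G (soft_compl U A H)"
    if "G \<in> \<tau>" for G
  proof -
    have "G a \<subseteq> U" "H a \<subseteq> U" if "a \<in> A" for a
      using soft_sets_subset[OF assms(2) that] open_subset[OF \<open>G \<in> \<tau>\<close> that] by blast+
    then show ?thesis
      by (fastforce simp: soft_subset_def soft_compl_def)
  qed
  with open_subset show
    "soft_compl U A (soft_closure U A \<tau> H) a = soft_interior A \<tau> (soft_compl U A H) a"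
    by (cases "a \<in> A")
      (auto simp: soft_compl_def[of U A "soft_closure U A \<tau> H"] soft_closure_def soft_Inter_def
        soft_interior_def soft_Union_def soft_closed_def,
       auto simp: soft_compl_def)
qed

lemma soft_semiclosed_compl_iff:
  assumes top: "soft_topology U A \<tau>" and G: "G \<in> soft_sets U A"
  shows "soft_semiclosed U A \<tau> (soft_compl U A G) \<longleftrightarrow> soft_semiopen U A \<tau> G"
proof -
  have "soft_subset A (soft_interior A \<tau> (soft_compl U A H)) (soft_compl U A G)
      \<longleftrightarrow> soft_subset A G (soft_closure U A \<tau> H)"
    and "soft_subset A (soft_compl U A G) (soft_compl U A H) \<longleftrightarrow> soft_subset A H G"
    if "H \<in> \<tau>" for H
  proof -
    have H: "H \<in> soft_sets U A"
      using soft_open_in_soft_sets[OF top that] .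
    have "soft_closure U A \<tau> H \<in> soft_sets U A"
      unfolding soft_closure_def by (rule soft_Inter_in_soft_sets)
    then show "soft_subset A (soft_interior A \<tau> (soft_compl U A H)) (soft_compl U A G)
        \<longleftrightarrow> soft_subset A G (soft_closure U A \<tau> H)"
      using soft_subset_compl_iff[OF _ G] by (simp flip: soft_compl_closure[OF top H])
    show "soft_subset A (soft_compl U A G) (soft_compl U A H) \<longleftrightarrow> soft_subset A H G"
      using soft_subset_compl_iff[OF G H] .
  qed
  then show ?thesis
    unfolding soft_semiclosed_def soft_semiopen_def soft_closed_def
    using G soft_compl_in_soft_sets by blast
qed

lemma soft_semiclosed_iff_interior_closure:
  assumes top: "soft_topology U A \<tau>" and F: "F \<in> soft_sets U A"
  shows "soft_semiclosed U A \<tau> F \<longleftrightarrow>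
    soft_subset A (soft_interior A \<tau> (soft_closure U A \<tau> F)) F"
proof
  assume "soft_semiclosed U A \<tau> F"
  then obtain K where K: "soft_closed U A \<tau> K" "soft_subset A F K"
    and int: "soft_subset A (soft_interior A \<tau> K) F"
    by (auto simp: soft_semiclosed_def)
  show "soft_subset A (soft_interior A \<tau> (soft_closure U A \<tau> F)) F"
    by (rule soft_subset_trans[OF soft_interior_mono[OF soft_closure_subset[OF K]] int])
next
  assume "soft_subset A (soft_interior A \<tau> (soft_closure U A \<tau> F)) F"
  then show "soft_semiclosed U A \<tau> F"
    unfolding soft_semiclosed_def
    using F soft_closed_closure[OF top] subset_soft_closure[OF F] by blast
qed

lemma soft_semiclosed_Inter:
  assumes top: "soft_topology U A \<tau>"
    and semi: "\<And>F. F \<in> \<F> \<Longrightarrow> soft_semiclosed U A \<tau> F"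
  shows "soft_semiclosed U A \<tau> (soft_Inter U A \<F>)"
proof -
  let ?I = "soft_Inter U A \<F>"
  let ?ic = "\<lambda>F. soft_interior A \<tau> (soft_closure U A \<tau> F)"
  have "soft_subset A (?ic ?I) F" if "F \<in> \<F>" for F
  proof -
    have "F \<in> soft_sets U A"
      using semi[OF that] by (simp add: soft_semiclosed_def)
    then have "soft_subset A (?ic F) F"
      using semi[OF that] soft_semiclosed_iff_interior_closure[OF top] by blast
    with soft_interior_mono[OF soft_closure_mono[OF soft_Inter_lower[OF that]]]
    show ?thesis by (rule soft_subset_trans)
  qed
  moreover have "?ic ?I \<in> soft_sets U A"
    using top by (auto simp: soft_topology_def soft_interior_def)
  ultimately show ?thesis
    by (simp add: soft_semiclosed_iff_interior_closure[OF top soft_Inter_in_soft_sets]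
        soft_Inter_greatest)
qed

lemma soft_semiclosed_sscl:
  "soft_topology U A \<tau> \<Longrightarrow> soft_semiclosed U A \<tau> (sscl U A \<tau> F)"
  unfolding sscl_def by (rule soft_semiclosed_Inter) auto

lemma sscl_subset:
  "soft_semiclosed U A \<tau> G \<Longrightarrow> soft_subset A F G \<Longrightarrow> soft_subset A (sscl U A \<tau> F) G"
  unfolding sscl_def by (rule soft_Inter_lower) simp

lemma subset_sscl: "F \<in> soft_sets U A \<Longrightarrow> soft_subset A F (sscl U A \<tau> F)"
  unfolding sscl_def by (rule soft_Inter_greatest) auto

lemma soft_image_in_soft_sets:
  assumes "soft_function U A B u p" "F \<in> soft_sets U A"
  shows "soft_image A B u p F \<in> soft_sets U B"
  using assms unfolding soft_function_def soft_sets_def soft_image_def by fastforce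

lemma soft_image_subset_iff:
  assumes "soft_function U A B u p" "F \<in> soft_sets U A"
  shows "soft_subset B (soft_image A B u p F) G \<longleftrightarrow> soft_subset A F (soft_vimage U A u p G)"
proof -
  have "p a \<in> B" "F a \<subseteq> U" if "a \<in> A" for a
    using assms that by (auto simp: soft_function_def soft_sets_def)
  then show ?thesis
    unfolding soft_subset_def soft_image_def soft_vimage_def by fastforce
qed

lemma soft_vimage_compl:
  assumes "soft_function U A B u p"
  shows "soft_vimage U A u p (soft_compl U B G) = soft_compl U A (soft_vimage U A u p G)"
  using assms by (auto simp: soft_function_def soft_vimage_def soft_compl_def fun_eq_iff)

lemma soft_semicontinuous_iff_closed:
  assumes top: "soft_topology U A \<tau>" and f: "soft_function U A B u p"
  shows "soft_semicontinuous U A \<tau> \<delta> u p \<longleftrightarrow>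
    (\<forall>K. soft_closed U B \<delta> K \<longrightarrow> soft_semiclosed U A \<tau> (soft_vimage U A u p K))"
  unfolding soft_semicontinuous_def soft_closed_def
  using soft_semiclosed_compl_iff[OF top soft_vimage_in_soft_sets] soft_vimage_compl[OF f]
  by metis

theorem theorem3p3:
  fixes U :: "'u set" and A :: "'a set" and B :: "'b set"
    and \<tau> :: "('a \<Rightarrow> 'u set) set" and \<delta> :: "('b \<Rightarrow> 'u set) set"
    and u :: "'u \<Rightarrow> 'u" and p :: "'a \<Rightarrow> 'b"
  assumes "soft_topology U A \<tau>" and "soft_topology U B \<delta>"
    and "soft_function U A B u p"
  shows "soft_semicontinuous U A \<tau> \<delta> u p \<longleftrightarrow>
    (\<forall>F\<in>soft_sets U A.
      soft_subset B (soft_image A B u p (sscl U A \<tau> F))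
        (soft_closure U B \<delta> (soft_image A B u p F)))"
proof -
  note top = assms(1) and f = assms(3)
  have sscl: "sscl U A \<tau> F \<in> soft_sets U A" for F
    unfolding sscl_def by (rule soft_Inter_in_soft_sets)
  show ?thesis
    unfolding soft_semicontinuous_iff_closed[OF top f]
  proof (intro iffI ballI allI impI)
    fix F
    assume semi: "\<forall>K. soft_closed U B \<delta> K \<longrightarrow> soft_semiclosed U A \<tau> (soft_vimage U A u p K)"
      and F: "F \<in> soft_sets U A"
    have "soft_subset B (soft_image A B u p (sscl U A \<tau> F)) K"
      if "soft_closed U B \<delta> K" "soft_subset B (soft_image A B u p F) K" for K
      using that semi sscl_subset soft_image_subset_iff[OF f F] soft_image_subset_iff[OF f sscl]
      by blast
    then show "soft_subset B (soft_image A B u p (sscl U A \<tau> F))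
        (soft_closure U B \<delta> (soft_image A B u p F))"
      unfolding soft_closure_def
      by (intro soft_Inter_greatest soft_image_in_soft_sets[OF f sscl]) auto
  next
    fix K
    assume image: "\<forall>F\<in>soft_sets U A. soft_subset B (soft_image A B u p (sscl U A \<tau> F))
        (soft_closure U B \<delta> (soft_image A B u p F))"
      and K: "soft_closed U B \<delta> K"
    define F where "F = soft_vimage U A u p K"
    have F: "F \<in> soft_sets U A"
      unfolding F_def by (rule soft_vimage_in_soft_sets)
    have "soft_subset B (soft_image A B u p F) K"
      unfolding soft_image_subset_iff[OF f F] by (simp add: F_def soft_subset_def)
    then have "soft_subset B (soft_image A B u p (sscl U A \<tau> F)) K"
      using image F soft_closure_subset[OF K] soft_subset_trans by blast
    then have "soft_subset A (sscl U A \<tau> F) F"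
      by (simp add: soft_image_subset_iff[OF f sscl] F_def)
    then have "F = sscl U A \<tau> F"
      using soft_subset_antisym[OF F sscl] subset_sscl[OF F] by blast
    then show "soft_semiclosed U A \<tau> (soft_vimage U A u p K)"
      using soft_semiclosed_sscl[OF top, of F] by (simp add: F_def)
  qed
qed

end
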